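(* The price of stability of financial network games under priority-proportional strategies is unbounded if negative external assets are allowed and firms aim to maximize their total assets: for every $R>0$ there is a financial network with debt contracts only, real (possibly negative) external assets and no default costs, whose game has price of stability at least $R$.
   Context: Financial network: firms $v_1,\dots,v_n$; each $v_i$ has external assets $e_i\in\mathbb{R}$, possibly negative (a negative value represents an obligation to entities outside the network, which absorbs incoming payments first); $v_i$ owes $v_j$ the liability $l_{ij}\ge 0$, with $l_{ii}=0$ (both $l_{ij}>0$ and $l_{ji}>0$ are allowed); $L_i=\sum_j l_{ij}$. Priority-proportional strategy: a strategy $s_i$ of $v_i$ is a complete ordering, allowing ties, of its creditors, i.e. an ordered partition of $\{v_j: l_{ij}>0\}$ into priority classes $1,2,\dots$. Write $L_i^{(m)}$ for the total liability of $v_i$ to its $m$-th class, $k_{ij}$ for the index of the class of $v_i$ containing $v_j$, and $\pi'_{ij}=l_{ij}/L_i^{(k_{ij})}$. Clearing payments consistent with a strategy profile $\mathbf{s}=(s_1,\dots,s_n)$: a matrix $\mathbf{P}=(p_{ij})$ with $p_{ii}=0$, $0\le p_{ij}\le l_{ij}$ and, writing $p_i=\sum_j p_{ij}$, for every $i$: $p_i=L_i$ if $L_i\le e_i+\sum_j p_{ji}$, and $p_i=\max\{0,\,e_i+\sum_j p_{ji}\}$ otherwise; moreover for every creditor $v_j$ of $v_i$, $$p_{ij}=\min\Big\{\max\Big\{\Big(p_i-\sum_{m=1}^{k_{ij}-1}L_i^{(m)}\Big)\pi'_{ij},\,0\Big\},\,l_{ij}\Big\},$$ and $p_{ij}=0$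 if $l_{ij}=0$. Clearing payments are proper if every firm with a positive outgoing payment is reachable, by a (possibly trivial) directed path of edges $(v_i,v_j)$ with $p_{ij}>0$, from some firm with positive external assets. Only proper clearing payments are considered. For every profile $\mathbf{s}$ there are maximal ones, denoted $\mathbf{P}(\mathbf{s})$, which are entrywise at least as large as all other proper clearing payments consistent with $\mathbf{s}$. Total assets: $a_i(\mathbf{P})=e_i+\sum_j p_{ji}$. The utility of $v_i$ under $\mathbf{s}$ is $a_i(\mathbf{P}(\mathbf{s}))$. A profile is a (pure) Nash equilibrium if no firm can strictly increase its utility by unilaterally changing its priority-proportional strategy. Social welfare: $SW(\mathbf{P})=\sum_i a_i(\mathbf{P})$; $OPT$ is the maximum of $SW(\mathbf{P}(\mathbf{s}))$ over all strategy profiles. The price of stability of an instance possessing at least one Nash equilibrium is the minimum of $OPT/SW(\mathbf{P}(\mathbf{s}))$ over Nash equilibria $\mathbf{s}$. *)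

theory Defs
  imports Complex_Main "HOL-Library.Disjoint_Sets" "HOL-Library.FuncSet"
begin

text \<open>
  Firms are the indices below \<open>n\<close>; \<open>e i\<close> is the (possibly negative) external asset value of
  firm \<open>i\<close>, and \<open>l i j\<close> is what firm \<open>i\<close> owes to firm \<open>j\<close>. The values of \<open>e\<close> and \<open>l\<close> at
  other indices play no role.
\<close>

locale financial_network =
  fixes n :: nat and e :: "nat \<Rightarrow> real" and l :: "nat \<Rightarrow> nat \<Rightarrow> real"
  assumes liability_nonneg: "\<And>i j. i < n \<Longrightarrow> j < n \<Longrightarrow> 0 \<le> l i j"
    and no_self_liability: "\<And>i. i < n \<Longrightarrow> l i i = 0"
begin

definition total_liability :: "nat \<Rightarrow> real" where
  "total_liability i = (\<Sum>j<n. l i j)"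

definition creditors :: "nat \<Rightarrow> nat set" where
  "creditors i = {j. j < n \<and> l i j > 0}"

text \<open>
  An ordered partition is the list of its classes, highest priority first. List positions
  start at 0, so the \<open>m\<close>-th priority class (counted from 1) is at position \<open>m - 1\<close>.
\<close>

definition strategies :: "nat \<Rightarrow> nat set list set" where
  "strategies i = {C. distinct C \<and> partition_on (creditors i) (set C)}"

definition profiles :: "(nat \<Rightarrow> nat set list) set" where
  "profiles = (\<Pi>\<^sub>E i\<in>{..<n}. strategies i)"

definition class_liability :: "nat \<Rightarrow> nat set list \<Rightarrow> nat \<Rightarrow> real" where
  "class_liability i C m = (\<Sum>j\<in>C ! m. l i j)"

definition class_index :: "nat set list \<Rightarrow> nat \<Rightarrow> nat" where
  "class_index C j = (THE m. m < length C \<and> j \<in> C ! m)"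

definition relative_liability :: "nat \<Rightarrow> nat set list \<Rightarrow> nat \<Rightarrow> real" where
  "relative_liability i C j = l i j / class_liability i C (class_index C j)"

definition outgoing :: "(nat \<Rightarrow> nat \<Rightarrow> real) \<Rightarrow> nat \<Rightarrow> real" where
  "outgoing P i = (\<Sum>j<n. P i j)"

definition total_assets :: "(nat \<Rightarrow> nat \<Rightarrow> real) \<Rightarrow> nat \<Rightarrow> real" where
  "total_assets P i = e i + (\<Sum>j<n. P j i)"

text \<open>
  A payment matrix is a function on all pairs of naturals that vanishes outside the network,
  so that equal matrices are equal functions.
\<close>

definition clearing :: "(nat \<Rightarrow> nat set list) \<Rightarrow> (nat \<Rightarrow> nat \<Rightarrow> real) \<Rightarrow> bool" where
  "clearing s P \<longleftrightarrow>
     (\<forall>i j. \<not> (i < n \<and> j < n) \<longrightarrow> P i j = 0) \<and>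
     (\<forall>i<n. P i i = 0) \<and>
     (\<forall>i<n. \<forall>j<n. 0 \<le> P i j \<and> P i j \<le> l i j) \<and>
     (\<forall>i<n. outgoing P i =
        (if total_liability i \<le> total_assets P i then total_liability i
         else max 0 (total_assets P i))) \<and>
     (\<forall>i<n. \<forall>j\<in>creditors i. P i j =
        min (max ((outgoing P i - (\<Sum>m<class_index (s i) j. class_liability i (s i) m))
                    * relative_liability i (s i) j)
                 0)
            (l i j)) \<and>
     (\<forall>i<n. \<forall>j<n. l i j = 0 \<longrightarrow> P i j = 0)"

definition proper :: "(nat \<Rightarrow> nat \<Rightarrow> real) \<Rightarrow> bool" where
  "proper P \<longleftrightarrow>
     (\<forall>i<n. outgoing P i > 0 \<longrightarrow>
        (\<exists>k<n. e k > 0 \<and> (k, i) \<in> {(u, v). u < n \<and> v < n \<and> P u v > 0}\<^sup>*))"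

text \<open>The order on matrices used by \<open>GREATEST\<close> is the entrywise (pointwise) one.\<close>

definition max_payments :: "(nat \<Rightarrow> nat set list) \<Rightarrow> nat \<Rightarrow> nat \<Rightarrow> real" where
  "max_payments s = (GREATEST P. clearing s P \<and> proper P)"

definition utility :: "(nat \<Rightarrow> nat set list) \<Rightarrow> nat \<Rightarrow> real" where
  "utility s i = total_assets (max_payments s) i"

definition nash_equilibrium :: "(nat \<Rightarrow> nat set list) \<Rightarrow> bool" where
  "nash_equilibrium s \<longleftrightarrow>
     s \<in> profiles \<and> (\<forall>i<n. \<forall>C\<in>strategies i. utility (s(i := C)) i \<le> utility s i)"

definition social_welfare :: "(nat \<Rightarrow> nat \<Rightarrow> real) \<Rightarrow> real" where
  "social_welfare P = (\<Sum>i<n. total_assets P i)"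

definition OPT :: real where
  "OPT = Max ((\<lambda>s. social_welfare (max_payments s)) ` profiles)"

text \<open>
  This value is meaningful only if there is a Nash equilibrium. An equilibrium of welfare 0
  contributes the ratio 0, and one of negative welfare a ratio of at most 1. Hence a value
  above 1 means that all equilibria have positive welfare.
\<close>

definition price_of_stability :: real where
  "price_of_stability =
     Min ((\<lambda>s. OPT / social_welfare (max_payments s)) ` {s. nash_equilibrium s})"

lemma finite_strategies: "finite (strategies i)"
proof -
  have "finite (Pow (creditors i))"
    by (simp add: creditors_def)
  then have "finite {C. set C \<subseteq> Pow (creditors i) \<and> distinct C}"
    by (rule finite_subset_distinct)
  then show ?thesis
    by (rule rev_finite_subset) (auto simp: strategies_def partition_on_def)
qed

lemma finite_profiles: "finite profiles"
  by (simp add: profiles_def finite_PiE finite_strategies)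

lemma finite_nash_equilibria: "finite {s. nash_equilibrium s}"
  by (rule finite_subset[OF _ finite_profiles]) (auto simp: nash_equilibrium_def)

end

end

theory Submission
  imports Defs
begin

text \<open>
  Take four firms with external assets \<open>4, -2, -3, 0\<close>. Firm 0 owes 4 to each of the firms 1 and 2,
  firm 1 owes 2 to firm 0, and the firms 2 and 3 owe \<open>M\<close> to each other; only firm 0 has a choice.
  If it pays firm 1 first, then 2 of its 4 units come back, and firm 2 receives the remaining 2
  units, which its external obligation swallows, so the cycle between 2 and 3 carries nothing.
  If it pays firm 2 first, one unit gets past the obligation and the whole cycle of volume
  \<open>M\<close> clears, but firm 0 gets nothing back. With a tie, firm 1 receives only what it owes
  outside, and again nothing returns. So paying firm 1 first is the only equilibrium, of welfare 7,
  whereas the optimum is at least \<open>2 * M + 3\<close>.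
\<close>

text \<open>Firm 1 stays the literal \<open>1\<close>, the form in which the simp rules below
  mention it.\<close>

declare One_nat_def [simp del]

text \<open>The five parameters sit on the five debt edges. One template serves both the
  liabilities, \<open>flow 4 4 2 M M\<close>, and every candidate for clearing payments.\<close>

definition flow :: "real \<Rightarrow> real \<Rightarrow> real \<Rightarrow> real \<Rightarrow> real \<Rightarrow> nat \<Rightarrow> nat \<Rightarrow> real" where
  "flow a b c d f i j =
     (if i = 0 \<and> j = 1 then a else if i = 0 \<and> j = 2 then b else if i = 1 \<and> j = 0 then c
      else if i = 2 \<and> j = 3 then d else if i = 3 \<and> j = 2 then f else 0)"

definition external :: "nat \<Rightarrow> real" where
  "external i = (if i = 0 then 4 else if i = 1 then - 2 else if i = 2 then - 3 else 0)"

lemma flow_simps [simp]: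
  "flow a b c d f 0 1 = a" "flow a b c d f 0 2 = b" "flow a b c d f 1 0 = c"
  "flow a b c d f 2 3 = d" "flow a b c d f 3 2 = f"
  "flow a b c d f i i = 0"
  "flow a b c d f 0 3 = 0" "flow a b c d f 1 2 = 0" "flow a b c d f 1 3 = 0"
  "flow a b c d f 2 0 = 0" "flow a b c d f 2 1 = 0"
  "flow a b c d f 3 0 = 0" "flow a b c d f 3 1 = 0"
  by (auto simp: flow_def)

lemma external_simps [simp]:
  "external 0 = 4" "external 1 = - 2" "external 2 = - 3" "external 3 = 0"
  by (auto simp: external_def)

lemma flow_le_iff:
  "flow a b c d f \<le> flow a' b' c' d' f' \<longleftrightarrow> a \<le> a' \<and> b \<le> b' \<and> c \<le> c' \<and> d \<le> d' \<and> f \<le> f'"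
proof
  assume "flow a b c d f \<le> flow a' b' c' d' f'"
  then have "flow a b c d f i j \<le> flow a' b' c' d' f' i j" for i j
    by (simp add: le_fun_def)
  from this[of 0 1] this[of 0 2] this[of 1 0] this[of 2 3] this[of 3 2]
  show "a \<le> a' \<and> b \<le> b' \<and> c \<le> c' \<and> d \<le> d' \<and> f \<le> f'" by simp
qed (auto simp: le_fun_def flow_def)

lemma less_4_iff: "i < 4 \<longleftrightarrow> i = 0 \<or> i = 1 \<or> i = 2 \<or> i = (3::nat)"
  by auto

lemma less_4_all: "(\<forall>i<4. Q i) \<longleftrightarrow> Q 0 \<and> Q 1 \<and> Q 2 \<and> Q (3::nat)"
  by (auto simp: less_4_iff)

lemma lessThan_4: "{..<4} = {0, 1, 2, 3::nat}"
  by auto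

section \<open>Ordered partitions of one- and two-element sets\<close>

lemma partition_on_singleton_iff: "partition_on {x} A \<longleftrightarrow> A = {{x}}"
proof
  assume A: "partition_on {x} A"
  then have "B = {x}" if "B \<in> A" for B
    using that subset_singletonD[of B x] by (auto simp: partition_on_def)
  moreover have "A \<noteq> {}"
    using A by (auto simp: partition_on_def)
  ultimately show "A = {{x}}" by auto
qed (auto simp: partition_on_def disjoint_def)

text \<open>The block \<open>{x, y}\<close> meets every other block, so it can only stand alone;
  without it just the two singletons remain, and covering requires both.\<close>

lemma partition_on_doubleton_iff:
  assumes "x \<noteq> y"
  shows "partition_on {x, y} A \<longleftrightarrow> A = {{x}, {y}} \<or> A = {{x, y}}"
proof
  assume A: "partition_on {x, y} A"
  have *: "B = {x} \<or> B = {y} \<or> B = {x, y}" if "B \<in> A" for B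
  proof -
    have "B \<subseteq> {x, y}" "B \<noteq> {}"
      using A that by (auto simp: partition_on_def)
    then show ?thesis by blast
  qed
  have U: "\<Union>A = {x, y}" and D: "disjoint A" using A by (auto simp: partition_on_def)
  show "A = {{x}, {y}} \<or> A = {{x, y}}"
  proof (cases "{x, y} \<in> A")
    case True
    then have "B = {x, y}" if "B \<in> A" for B
      using D that * by (auto simp: disjoint_def)
    with True have "A = {{x, y}}" by blast
    then show ?thesis ..
  next
    case False
    then have "A \<subseteq> {{x}, {y}}" using * by auto
    moreover have "{x} \<in> A" "{y} \<in> A"
      using U * False by (metis UnionE insert_iff singletonD)+
    ultimately show ?thesis by auto
  qed
qed (use assms in \<open>auto simp: partition_on_def disjoint_def\<close>)

lemma distinct_set_singleton_iff: "distinct C \<and> set C = {x} \<longleftrightarrow> C = [x]"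
proof
  assume C: "distinct C \<and> set C = {x}"
  then have "length C = 1" by (metis distinct_card is_singleton_altdef is_singletonI)
  with C show "C = [x]" by (cases C) auto
qed auto

lemma distinct_set_doubleton_iff:
  assumes "x \<noteq> y"
  shows "distinct C \<and> set C = {x, y} \<longleftrightarrow> C = [x, y] \<or> C = [y, x]"
proof
  assume C: "distinct C \<and> set C = {x, y}"
  then have "length C = 2" using assms distinct_card[of C] by auto
  then obtain a b where "C = [a, b]" by (auto simp: numeral_2_eq_2 length_Suc_conv)
  with C show "C = [x, y] \<or> C = [y, x]" by (auto simp: doubleton_eq_iff)
qed (use assms in auto)

section \<open>The network with cycle volume \<open>M\<close> and its profiles\<close>

context
  fixes M :: real
  assumes M: "M > 0"
begin

interpretation financial_network 4 external "flow 4 4 2 M M"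
  using M by unfold_locales (auto simp: flow_def)

lemma creditors_simps:
  "creditors 0 = {1, 2}" "creditors 1 = {0}" "creditors 2 = {3}" "creditors 3 = {2}"
  using M unfolding creditors_def by (auto simp: less_4_iff)

lemma strategies_simps:
  "strategies 0 = {[{1}, {2}], [{2}, {1}], [{1, 2}]}"
  "strategies 1 = {[{0}]}" "strategies 2 = {[{3}]}" "strategies 3 = {[{2}]}"
  unfolding strategies_def creditors_simps
  by (auto simp: partition_on_singleton_iff partition_on_doubleton_iff conj_disj_distribL
      distinct_set_singleton_iff distinct_set_doubleton_iff)

text \<open>Firms 1 to 3 have one creditor each, so firm 0's list determines the profile. The value
  \<open>undefined\<close> elsewhere matches the extensional functions in
  \<open>profiles\<close>.\<close>

definition profile :: "nat set list \<Rightarrow> nat \<Rightarrow> nat set list" where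
  "profile C = (\<lambda>i. if i = 0 then C else if i = 1 then [{0}] else if i = 2 then [{3}]
     else if i = 3 then [{2}] else undefined)"

lemma profiles_eq: "profiles = profile ` strategies 0"
proof
  show "profiles \<subseteq> profile ` strategies 0"
  proof
    fix s assume s: "s \<in> profiles"
    then have "s i \<in> strategies i" if "i < 4" for i
      using that by (auto simp: profiles_def)
    from this[of 0] this[of 1] this[of 2] this[of 3]
    have "s 0 \<in> strategies 0" "s 1 = [{0}]" "s 2 = [{3}]" "s 3 = [{2}]"
      by (simp_all add: strategies_simps(2-))
    moreover have "s i = undefined" if "\<not> i < 4" for i
      using PiE_arb[of s "{..<4}" strategies i] s that by (simp add: profiles_def)
    ultimately have "s = profile (s 0)"
      by (auto simp: profile_def fun_eq_iff less_4_iff)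
    then show "s \<in> profile ` strategies 0" using \<open>s 0 \<in> _\<close> by blast
  qed
  show "profile ` strategies 0 \<subseteq> profiles"
  proof
    fix s assume "s \<in> profile ` strategies 0"
    then obtain C where C: "C \<in> strategies 0" and s: "s = profile C" by blast
    show "s \<in> profiles"
      unfolding profiles_def
    proof (rule PiE_I)
      fix i :: nat assume "i \<in> {..<4}"
      then consider "i = 0" | "i = 1" | "i = 2" | "i = 3" by (auto simp: less_4_iff)
      then show "s i \<in> strategies i"
        using C by cases (simp_all add: s profile_def strategies_simps(2-))
    qed (auto simp: s profile_def)
  qed
qed

section \<open>Clearing payments for each strategy of firm 0\<close>

lemma class_index_simps:
  "class_index [{j}] j = 0"
  "class_index [{x, y}] x = 0" "class_index [{x, y}] y = 0"
  "x \<noteq> y \<Longrightarrow> class_index [{x}, {y}] x = 0"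
  "x \<noteq> y \<Longrightarrow> class_index [{x}, {y}] y = 1"
  unfolding class_index_def by (rule the_equality; auto simp: less_Suc_eq One_nat_def)+

text \<open>Payments vanish where nothing is owed, so finding clearing payments becomes a problem in
  five real unknowns.\<close>

lemma clearing_imp_flow:
  assumes "clearing s P"
  shows "P = flow (P 0 1) (P 0 2) (P 1 0) (P 2 3) (P 3 2)"
proof -
  have *: "P i j = 0" if "flow 4 4 2 M M i j = 0" for i j
    using assms that by (cases "i < 4 \<and> j < 4") (simp_all add: clearing_def)
  show ?thesis
  proof (intro ext)
    fix i j
    show "P i j = flow (P 0 1) (P 0 2) (P 1 0) (P 2 3) (P 3 2) i j"
    proof (cases "(i, j) \<in> {(0, 1), (0, 2), (1, 0), (2, 3), (3, 2)}")
      case False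
      then have "flow a b c d f i j = 0" for a b c d f
        by (auto simp: flow_def)
      with * show ?thesis by simp
    qed auto
  qed
qed

text \<open>Firm 0 owes 8 but holds \<open>4 + c\<close>, at most 6, so it pays out everything. Firm
  3 receives at most the \<open>M\<close> it owes and passes it all on, whence \<open>f = d\<close>.
  The priority rule restricts only firm 0, the others having a single creditor.\<close>

lemma clearing_flow_iff:
  "clearing (profile C) (flow a b c d f) \<longleftrightarrow>
     0 \<le> a \<and> a \<le> 4 \<and> 0 \<le> b \<and> b \<le> 4 \<and> 0 \<le> d \<and>
     a + b = 4 + c \<and> c = min 2 (max 0 (a - 2)) \<and> d = min M (max 0 (b + d - 3)) \<and> f = d \<and>
     (\<forall>j\<in>{1,2}. flow a b c d f 0 j = min (max ((a + b - (\<Sum>m<class_index C j. class_liability 0 C m))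
         * relative_liability 0 C j) 0) 4)"
proof -
  let ?P = "flow a b c d f"
  have prof: "profile C 0 = C" "profile C 1 = [{0}]" "profile C 2 = [{3}]" "profile C 3 = [{2}]"
    by (simp_all add: profile_def)
  have out: "outgoing ?P 0 = a + b" "outgoing ?P 1 = c" "outgoing ?P 2 = d" "outgoing ?P 3 = f"
    by (simp_all add: outgoing_def lessThan_4)
  have liab: "total_liability 0 = 8" "total_liability 1 = 2" "total_liability 2 = M"
    "total_liability 3 = M"
    by (simp_all add: total_liability_def lessThan_4)
  have assets: "total_assets ?P 0 = 4 + c" "total_assets ?P 1 = a - 2"
    "total_assets ?P 2 = b + f - 3" "total_assets ?P 3 = d"
    by (simp_all add: total_assets_def lessThan_4)
  have rel: "relative_liability 1 [{0}] 0 = 1" "relative_liability 2 [{3}] 3 = 1"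
    "relative_liability 3 [{2}] 2 = 1"
    using M by (simp_all add: relative_liability_def class_liability_def class_index_simps)
  have supp: "\<forall>i j. \<not> (i < 4 \<and> j < 4) \<longrightarrow> ?P i j = 0" by (auto simp: flow_def)
  show ?thesis
    unfolding clearing_def less_4_all creditors_simps prof out liab assets
    by (simp add: supp prof out liab assets rel class_index_simps split del: if_split)
      (use M in \<open>smt (verit)\<close>)
qed

text \<open>Dominating all clearing payments includes dominating the proper ones, so properness is
  checked for one matrix only.\<close>

lemma clearing_max_payments:
  assumes "clearing s P" "proper P" "\<And>Q. clearing s Q \<Longrightarrow> Q \<le> P"
  shows "max_payments s = P"
  unfolding max_payments_def using assms by (intro Greatest_equality) auto

text \<open>Firm 0 alone has positive external assets. The hypotheses trace every used edge back to
  it: \<open>c\<close> is fed by \<open>a\<close>, \<open>f\<close> by \<open>d\<close>, and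
  \<open>d\<close> by \<open>b\<close>.\<close>

lemma proper_flow:
  assumes "c > 0 \<Longrightarrow> a > 0" "d > 0 \<Longrightarrow> b > 0" "f > 0 \<Longrightarrow> d > 0"
  shows "proper (flow a b c d f)"
  unfolding proper_def
proof (intro allI impI)
  let ?P = "flow a b c d f"
  let ?E = "{(u, v). u < 4 \<and> v < 4 \<and> ?P u v > 0}"
  fix i :: nat assume "i < 4" and pos: "outgoing ?P i > 0"
  have "(0, i) \<in> ?E\<^sup>*"
  proof -
    consider "i = 0" | "i = 1" | "i = 2" | "i = 3" using \<open>i < 4\<close> by (auto simp: less_4_iff)
    then show ?thesis
    proof cases
      case 2
      with pos assms have "(0, i) \<in> ?E" by (simp add: outgoing_def lessThan_4)
      then show ?thesis by blast
    next
      case 3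
      with pos assms have "(0, i) \<in> ?E" by (simp add: outgoing_def lessThan_4)
      then show ?thesis by blast
    next
      case 4
      with pos assms have "(0, 2) \<in> ?E" "(2, i) \<in> ?E" by (simp_all add: outgoing_def lessThan_4)
      then show ?thesis by (meson r_into_rtrancl rtrancl_trans)
    qed simp
  qed
  then show "\<exists>k<4. external k > 0 \<and> (k, i) \<in> ?E\<^sup>*"
    by (intro exI[of _ 0]) simp
qed

lemma relative_liability_simps:
  "relative_liability 0 [{1}, {2}] 1 = 1" "relative_liability 0 [{1}, {2}] 2 = 1"
  "relative_liability 0 [{2}, {1}] 1 = 1" "relative_liability 0 [{2}, {1}] 2 = 1"
  "relative_liability 0 [{1, 2}] 1 = 1 / 2" "relative_liability 0 [{1, 2}] 2 = 1 / 2"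
  by (simp_all add: relative_liability_def class_liability_def class_index_simps)

text \<open>Since \<open>a + b\<close> is at least 4, \<open>a = 4\<close>, which gives
  \<open>c = 2\<close> and \<open>b = 2\<close>. A round of the cycle then loses one unit, so a
  positive \<open>d\<close> would satisfy \<open>d \<le> d - 1\<close>.\<close>

lemma clearing_1_2_iff:
  "clearing (profile [{1}, {2}]) (flow a b c d f) \<longleftrightarrow> a = 4 \<and> b = 2 \<and> c = 2 \<and> d = 0 \<and> f = 0"
  using M unfolding clearing_flow_iff
  by (simp add: relative_liability_simps class_index_simps class_liability_def)
    (auto simp: min_def max_def split: if_splits)

text \<open>Here \<open>b = 4\<close> and \<open>a = c\<close>; a positive \<open>c\<close> would
  satisfy \<open>c \<le> a - 2\<close>. A round of the cycle gains one unit, so the remaining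
  equation forces \<open>d = M\<close>.\<close>

lemma clearing_2_1_iff:
  "clearing (profile [{2}, {1}]) (flow a b c d f) \<longleftrightarrow>
     a = 0 \<and> b = 4 \<and> c = 0 \<and> 0 \<le> d \<and> d = min M (d + 1) \<and> f = d"
  using M unfolding clearing_flow_iff
  by (simp add: relative_liability_simps class_index_simps class_liability_def)
    (auto simp: min_def max_def split: if_splits)

text \<open>Equal shares give \<open>a = 2 + c / 2\<close>, so firm 1 returns at most
  \<open>c / 2\<close>, forcing \<open>c = 0\<close>. The cycle again loses one unit per
  round.\<close>

lemma clearing_12_iff:
  "clearing (profile [{1, 2}]) (flow a b c d f) \<longleftrightarrow> a = 2 \<and> b = 2 \<and> c = 0 \<and> d = 0 \<and> f = 0"
  using M unfolding clearing_flow_iff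
  by (simp add: relative_liability_simps class_index_simps class_liability_def)
    (auto simp: min_def max_def split: if_splits)

section \<open>Maximal payments, equilibria and welfare\<close>

lemma max_payments_simps:
  "max_payments (profile [{1}, {2}]) = flow 4 2 2 0 0"
  "max_payments (profile [{2}, {1}]) = flow 0 4 0 M M"
  "max_payments (profile [{1, 2}]) = flow 2 2 0 0 0"
proof -
  \<comment> \<open>Every competitor is itself a \<open>flow\<close>, so comparing five entries
    suffices.\<close>
  have *: "max_payments s = flow a b c d f"
    if "clearing s (flow a b c d f)" "proper (flow a b c d f)"
      "\<And>a' b' c' d' f'. clearing s (flow a' b' c' d' f') \<Longrightarrow>
         a' \<le> a \<and> b' \<le> b \<and> c' \<le> c \<and> d' \<le> d \<and> f' \<le> f"
    for s a b c d f
  proof (rule clearing_max_payments)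
    fix Q assume Q: "clearing s Q"
    then have "clearing s (flow (Q 0 1) (Q 0 2) (Q 1 0) (Q 2 3) (Q 3 2))"
      using clearing_imp_flow by metis
    from that(3)[OF this] show "Q \<le> flow a b c d f"
      by (subst clearing_imp_flow[OF Q]) (simp add: flow_le_iff)
  qed (use that in auto)
  show "max_payments (profile [{1}, {2}]) = flow 4 2 2 0 0"
    by (rule *) (auto simp: clearing_1_2_iff intro: proper_flow)
  show "max_payments (profile [{2}, {1}]) = flow 0 4 0 M M"
    using M by (intro *) (auto simp: clearing_2_1_iff intro!: proper_flow)
  show "max_payments (profile [{1, 2}]) = flow 2 2 0 0 0"
    by (rule *) (auto simp: clearing_12_iff intro: proper_flow)
qed

text \<open>Each payment counts once, at its receiver; the external assets add up to
  \<open>-1\<close>.\<close>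

lemma social_welfare_flow: "social_welfare (flow a b c d f) = a + b + c + d + f - 1"
  by (simp add: social_welfare_def total_assets_def lessThan_4)

lemma utility_simps:
  "utility (profile [{1}, {2}]) 0 = 6" "utility (profile [{2}, {1}]) 0 = 4"
  "utility (profile [{1, 2}]) 0 = 4"
  by (simp_all add: utility_def max_payments_simps total_assets_def lessThan_4)

lemma profile_upd: "(profile C)(0 := D) = profile D"
  by (auto simp: profile_def)

lemma nash_equilibrium_iff: "nash_equilibrium s \<longleftrightarrow> s = profile [{1}, {2}]"
proof
  assume s: "nash_equilibrium s"
  then obtain C where C: "C \<in> strategies 0" "s = profile C"
    by (auto simp: nash_equilibrium_def profiles_eq)
  \<comment> \<open>One deviation excludes both other profiles: it earns firm 0 the amount 6 instead
    of 4.\<close>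
  have "utility (s(0 := [{1}, {2}])) 0 \<le> utility s 0"
    using s unfolding nash_equilibrium_def by (simp add: strategies_simps(1))
  with C show "s = profile [{1}, {2}]"
    by (auto simp: strategies_simps(1) profile_upd utility_simps)
next
  let ?s = "profile [{1}, {2}]"
  assume s: "s = ?s"
  have "utility (?s(i := C)) i \<le> utility ?s i" if "i < 4" "C \<in> strategies i" for i C
  proof (cases "i = 0")
    case True
    with that show ?thesis
      by (auto simp: strategies_simps(1) profile_upd utility_simps)
  next
    case False
    then consider "i = 1" | "i = 2" | "i = 3" using \<open>i < 4\<close> by (auto simp: less_4_iff)
    \<comment> \<open>A firm with a single creditor has no other strategy to deviate to.\<close>
    then have "C = ?s i"
      using that by cases (simp_all add: strategies_simps(2-) profile_def)
    then show ?thesis by simp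
  qed
  moreover have "?s \<in> profiles"
    by (simp add: profiles_eq strategies_simps(1))
  ultimately show "nash_equilibrium s"
    unfolding s nash_equilibrium_def by blast
qed

lemma price_of_stability_ge: "price_of_stability \<ge> (2 * M + 3) / 7"
proof -
  \<comment> \<open>A lower bound on \<open>OPT\<close> is enough, and this profile clears the whole
    cycle.\<close>
  have "social_welfare (max_payments (profile [{2}, {1}])) \<le> OPT"
    unfolding OPT_def
    by (intro Max_ge finite_imageI finite_profiles imageI)
      (simp add: profiles_eq strategies_simps(1))
  then have "2 * M + 3 \<le> OPT"
    by (simp add: max_payments_simps social_welfare_flow)
  \<comment> \<open>The equilibrium is unique, so the minimum is over a single ratio, with welfare
    \<open>4 + 2 + 2 - 1\<close>.\<close>
  moreover have "price_of_stability = OPT / 7"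
    unfolding price_of_stability_def nash_equilibrium_iff
    by (simp add: max_payments_simps social_welfare_flow)
  ultimately show ?thesis by simp
qed

lemma unbounded_instance:
  "financial_network 4 (flow 4 4 2 M M)"
  "financial_network.nash_equilibrium 4 external (flow 4 4 2 M M) (profile [{1}, {2}])"
  "financial_network.price_of_stability 4 external (flow 4 4 2 M M) \<ge> (2 * M + 3) / 7"
  using financial_network_axioms nash_equilibrium_iff price_of_stability_ge by simp_all

end

theorem theorem8:
  "\<forall>R::real. R > 0 \<longrightarrow>
     (\<exists>(n::nat) (e::nat \<Rightarrow> real) (l::nat \<Rightarrow> nat \<Rightarrow> real).
        financial_network n l \<and>
        (\<exists>s. financial_network.nash_equilibrium n e l s) \<and>
        financial_network.price_of_stability n e l \<ge> R)"
proof (intro allI impI)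
  fix R :: real assume "R > 0"
  \<comment> \<open>Cycle volume \<open>7 * R\<close> turns the bound into
    \<open>2 * R + 3 / 7\<close>, which exceeds \<open>R\<close>.\<close>
  then have M: "7 * R > 0" by simp
  have "R \<le> (2 * (7 * R) + 3) / 7" using \<open>R > 0\<close> by simp
  then show "\<exists>n e l. financial_network n l \<and>
        (\<exists>s. financial_network.nash_equilibrium n e l s) \<and>
        financial_network.price_of_stability n e l \<ge> R"
    using unbounded_instance[OF M] order_trans by blast
qed

end
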